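(* Let $G$ be a simple mixed graph on $n$ vertices, with integrated adjacency matrix $\mathcal{I}(G)$ and $\mathcal{I}$-eigenvalues $\boldsymbol{\lambda}_1(G)\ge\cdots\ge\boldsymbol{\lambda}_{2n}(G)$. Let $e(G)$ be the number of edges and $a(G)$ the number of arcs of $G$. Then: (i) $\sum_{i=1}^{2n}\boldsymbol{\lambda}_i(G)=0$; (ii) $\sum_{i=1}^{2n}\boldsymbol{\lambda}_i(G)^2=4e(G)+2a(G)$.
   Context: A mixed graph $G$ has a finite nonempty vertex set $V_G=\{v_1,\dots,v_n\}$, a finite set $E_G$ of (undirected) edges, each joining an unordered pair of vertices $\{u,v\}$ (a loop if $u=v$), and a finite set $\vec E_G$ of arcs, each going from $u$ to $v$ for an ordered pair $(u,v)$ of vertices (a directed loop if $u=v$); multiple edges, loops, arcs and directed loops are allowed. $G$ is simple if it has no loops, no directed loops, at most one edge joining any two vertices, and at most one arc from $u$ to $v$ for each ordered pair $(u,v)$ (an edge and arcs in both directions may coexist on the same pair of vertices). The integrated adjacency matrix $\mathcal{I}(G)$ is the real symmetric $2n\times 2n$ matrix $\begin{bmatrix}A&D\\ D^T&A\end{bmatrix}$, where $A_{ij}$ ($i\neq j$) is the number of edges joining $v_i$ and $v_j$, $A_{ii}$ is twice the number of loops at $v_i$, and $D_{ij}$ is the number of arcs from $v_i$ to $v_j$. Its eigenvalues, counted with multiplicity, are the $\mathcal{I}$-eigenvalues of $G$, arranged as $\boldsymbol{\lambda}_1(G)\ge\cdots\ge\boldsymbol{\lambda}_{2n}(G)$. 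*)

theory Defs
  imports "Jordan_Normal_Form.Char_Poly" "HOL-Library.Uprod"
begin

(* Edges and arcs are abstract objects with end points, so that parallel edges and
   parallel arcs are allowed; Upair u v is the unordered pair {u,v}, u = v being allowed. *)
record ('v, 'e, 'a) mixed_graph =
  verts :: "'v set"
  edges :: "'e set"
  ends  :: "'e \<Rightarrow> 'v uprod"
  arcs  :: "'a set"
  tail  :: "'a \<Rightarrow> 'v"
  head  :: "'a \<Rightarrow> 'v"

definition mixed_graph :: "('v, 'e, 'a) mixed_graph \<Rightarrow> bool" where
  "mixed_graph G \<longleftrightarrow>
     finite (verts G) \<and> verts G \<noteq> {} \<and>
     finite (edges G) \<and> (\<forall>e\<in>edges G. set_uprod (ends G e) \<subseteq> verts G) \<and>
     finite (arcs G) \<and> (\<forall>a\<in>arcs G. tail G a \<in> verts G \<and> head G a \<in> verts G)"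

definition simple_mixed_graph :: "('v, 'e, 'a) mixed_graph \<Rightarrow> bool" where
  "simple_mixed_graph G \<longleftrightarrow>
     mixed_graph G \<and>
     (\<forall>e\<in>edges G. \<forall>u. ends G e \<noteq> Upair u u) \<and>
     (\<forall>a\<in>arcs G. tail G a \<noteq> head G a) \<and>
     (\<forall>e\<in>edges G. \<forall>e'\<in>edges G. ends G e = ends G e' \<longrightarrow> e = e') \<and>
     (\<forall>a\<in>arcs G. \<forall>a'\<in>arcs G. tail G a = tail G a' \<and> head G a = head G a' \<longrightarrow> a = a')"

definition num_edges_between :: "('v, 'e, 'a) mixed_graph \<Rightarrow> 'v \<Rightarrow> 'v \<Rightarrow> nat" where
  "num_edges_between G u w = card {e \<in> edges G. ends G e = Upair u w}"

definition num_arcs_from_to :: "('v, 'e, 'a) mixed_graph \<Rightarrow> 'v \<Rightarrow> 'v \<Rightarrow> nat" where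
  "num_arcs_from_to G u w = card {a \<in> arcs G. tail G a = u \<and> head G a = w}"

(* In the following, v 0, ..., v (n - 1) enumerates the vertices of G, n = card (verts G). *)

definition edge_block :: "('v, 'e, 'a) mixed_graph \<Rightarrow> (nat \<Rightarrow> 'v) \<Rightarrow> real mat" where
  "edge_block G v = mat (card (verts G)) (card (verts G))
     (\<lambda>(i, j). if i = j then 2 * real (num_edges_between G (v i) (v i))
               else real (num_edges_between G (v i) (v j)))"

definition arc_block :: "('v, 'e, 'a) mixed_graph \<Rightarrow> (nat \<Rightarrow> 'v) \<Rightarrow> real mat" where
  "arc_block G v = mat (card (verts G)) (card (verts G))
     (\<lambda>(i, j). real (num_arcs_from_to G (v i) (v j)))"

definition integrated_adjacency_matrix ::
    "('v, 'e, 'a) mixed_graph \<Rightarrow> (nat \<Rightarrow> 'v) \<Rightarrow> real mat" where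
  "integrated_adjacency_matrix G v =
     four_block_mat (edge_block G v) (arc_block G v)
                    (transpose_mat (arc_block G v)) (edge_block G v)"

(* The i-th largest (i = 1, 2, ...) real root of the characteristic polynomial, counted with
   multiplicity. That there are 2 * card (verts G) of them, so that the list lookup
   is meaningful for 1 <= i <= 2 * card (verts G), is a consequence of the symmetry of
   the matrix and is not built into the definition. *)
definition I_eigenvalue ::
    "('v, 'e, 'a) mixed_graph \<Rightarrow> (nat \<Rightarrow> 'v) \<Rightarrow> nat \<Rightarrow> real" where
  "I_eigenvalue G v i =
     rev (sorted_list_of_multiset (proots (char_poly (integrated_adjacency_matrix G v)))) ! (i - 1)"

end

theory Submission
  imports Defs "Jordan_Normal_Form.Schur_Decomposition"
begin

text \<open>
  Let \<open>M\<close> be the integrated adjacency matrix, a real symmetric matrix of order \<open>2 n\<close>. The first two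
  power sums of its eigenvalues are the traces of \<open>M\<close> and of \<open>M * M\<close>. The first trace vanishes because
  the diagonal of \<open>M\<close> only records loops. By symmetry the second is the sum of the squares of all
  entries of \<open>M\<close>; in a simple graph every entry is 0 or 1, so the squares may be dropped and the sum
  counts adjacencies. Each of the two edge blocks counts every edge twice, once for
  each order of its end points, and the arc block and its transpose count every arc once; in total
  \<open>4 e(G) + 2 a(G)\<close>.

  The eigenvalues in question are the real roots of the characteristic polynomial. Before they can be
  matched with traces, the polynomial must be seen to have \<open>2 n\<close> real roots with
  multiplicity (\<open>char_poly_real_symmetric_splits\<close>): its complex roots are eigenvalues of a Hermitian
  matrix, hence real. Once it splits, a Schur decomposition makes \<open>M\<close> similar to an upper triangular
  matrix with the eigenvalues on the diagonal, from which both power sums can be read off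
  (\<open>trace_eq_sum_roots\<close>).
\<close>

section \<open>Traces of matrices with split characteristic polynomial\<close>

definition mat_trace :: "'a :: comm_monoid_add mat \<Rightarrow> 'a" where
  "mat_trace A = (\<Sum>i<dim_row A. A $$ (i, i))"

lemma mult_mat_index_sum:
  assumes "A \<in> carrier_mat n m" "B \<in> carrier_mat m k" "i < n" "j < k"
  shows "(A * B) $$ (i, j) = (\<Sum>l<m. A $$ (i, l) * B $$ (l, j))"
  using assms by (auto simp: scalar_prod_def lessThan_atLeast0 intro!: sum.cong)

lemma mat_trace_mult_commute:
  fixes A :: "'a :: comm_semiring_0 mat"
  assumes A: "A \<in> carrier_mat n m" and B: "B \<in> carrier_mat m n"
  shows "mat_trace (A * B) = mat_trace (B * A)"
proof -
  have "mat_trace (A * B) = (\<Sum>i<n. \<Sum>l<m. A $$ (i, l) * B $$ (l, i))"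
    unfolding mat_trace_def using A by (auto simp: mult_mat_index_sum[OF A B] intro!: sum.cong)
  also have "\<dots> = (\<Sum>l<m. \<Sum>i<n. B $$ (l, i) * A $$ (i, l))"
    by (subst sum.swap) (simp add: mult.commute)
  also have "\<dots> = mat_trace (B * A)"
    unfolding mat_trace_def using B by (auto simp: mult_mat_index_sum[OF B A] intro!: sum.cong)
  finally show ?thesis .
qed

lemma mat_trace_similar:
  fixes A :: "'a :: comm_ring_1 mat"
  assumes "similar_mat A B"
  shows "mat_trace A = mat_trace B"
proof -
  from similar_matD[OF assms] obtain n P Q where
    c: "A \<in> carrier_mat n n" "B \<in> carrier_mat n n" "P \<in> carrier_mat n n" "Q \<in> carrier_mat n n"
    and QP: "Q * P = 1\<^sub>m n" and A: "A = P * B * Q"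
    by auto
  have "mat_trace A = mat_trace (Q * (P * B))"
    unfolding A using c by (intro mat_trace_mult_commute[of _ n n]) auto
  also have "Q * (P * B) = (Q * P) * B"
    using c by (intro assoc_mult_mat[symmetric]) auto
  also have "\<dots> = B" using QP c by simp
  finally show ?thesis .
qed

lemma similar_mat_square:
  assumes "similar_mat A (B :: 'a :: comm_ring_1 mat)"
  shows "similar_mat (A * A) (B * B)"
proof -
  from similar_matD[OF assms] obtain n P Q where
    c: "A \<in> carrier_mat n n" "B \<in> carrier_mat n n" "P \<in> carrier_mat n n" "Q \<in> carrier_mat n n"
    and PQ: "P * Q = 1\<^sub>m n" and QP: "Q * P = 1\<^sub>m n" and A: "A = P * B * Q"
    by auto
  have "A * A = P * B * (Q * (P * (B * Q)))"
    unfolding A using c by (simp add: assoc_mult_mat[of _ n n _ n _ n])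
  also have "Q * (P * (B * Q)) = (Q * P) * (B * Q)"
    using c by (intro assoc_mult_mat[symmetric]) auto
  also have "\<dots> = B * Q" using QP c by simp
  also have "P * B * (B * Q) = P * (B * B) * Q"
    using c by (simp add: assoc_mult_mat[of _ n n _ n _ n])
  finally show ?thesis
    using c PQ QP by (intro similar_matI[of _ _ P Q n]) auto
qed

text \<open>In \<open>\<Sum>l. B\<^sub>i\<^sub>l B\<^sub>l\<^sub>i\<close> one factor lies strictly below the diagonal unless \<open>l = i\<close>.\<close>

lemma diag_square_upper_triangular:
  fixes B :: "'a :: comm_ring_1 mat"
  assumes B: "B \<in> carrier_mat n n" and ut: "upper_triangular B" and i: "i < n"
  shows "(B * B) $$ (i, i) = (B $$ (i, i))\<^sup>2"
proof -
  have "(B * B) $$ (i, i) = (\<Sum>l<n. B $$ (i, l) * B $$ (l, i))"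
    by (rule mult_mat_index_sum[OF B B i i])
  also have "\<dots> = (\<Sum>l<n. if l = i then (B $$ (i, i))\<^sup>2 else 0)"
  proof (rule sum.cong)
    fix l assume "l \<in> {..<n}"
    then show "B $$ (i, l) * B $$ (l, i) = (if l = i then (B $$ (i, i))\<^sup>2 else 0)"
      using upper_triangularD[OF ut, of l i] upper_triangularD[OF ut, of i l] B i
      by (cases l i rule: linorder_cases) (auto simp: power2_eq_square)
  qed simp
  also have "\<dots> = (B $$ (i, i))\<^sup>2" using i by simp
  finally show ?thesis .
qed

lemma sum_list_map_diag_mat:
  "sum_list (map f (diag_mat A)) = (\<Sum>i<dim_row A. f (A $$ (i, i)))"
  unfolding diag_mat_def by (simp add: sum_list_sum_nth lessThan_atLeast0)

text \<open>Both traces are invariant under similarity, so they may be computed on the triangular matrix of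
  a Schur decomposition, whose diagonal is \<open>es\<close>.\<close>

lemma trace_eq_sum_roots:
  fixes A :: "'a :: conjugatable_ordered_field mat"
  assumes A: "A \<in> carrier_mat n n" and cp: "char_poly A = (\<Prod>e\<leftarrow>es. [:- e, 1:])"
  shows "sum_list es = mat_trace A"
    and "sum_list (map (\<lambda>e. e\<^sup>2) es) = mat_trace (A * A)"
proof -
  obtain B P Q where "schur_decomposition A es = (B, P, Q)"
    by (cases "schur_decomposition A es") auto
  from schur_decomposition[OF A cp this]
  have sim: "similar_mat_wit A B P Q" and ut: "upper_triangular B" and diag: "diag_mat B = es"
    by auto
  from similar_mat_witD2[OF A sim] have B: "B \<in> carrier_mat n n" by auto
  from sim have sim': "similar_mat A B" unfolding similar_mat_def by blast
  show "sum_list es = mat_trace A"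
    using sum_list_map_diag_mat[of "\<lambda>x. x" B]
    unfolding mat_trace_similar[OF sim'] by (simp add: mat_trace_def diag)
  have "sum_list (map (\<lambda>e. e\<^sup>2) es) = mat_trace (B * B)"
    using sum_list_map_diag_mat[of "\<lambda>x. x\<^sup>2" B] B
    by (simp add: mat_trace_def diag diag_square_upper_triangular[OF B ut] del: index_mult_mat(1))
  then show "sum_list (map (\<lambda>e. e\<^sup>2) es) = mat_trace (A * A)"
    by (simp add: mat_trace_similar[OF similar_mat_square[OF sim']])
qed

text \<open>Symmetry turns the products \<open>A\<^sub>i\<^sub>j A\<^sub>j\<^sub>i\<close> on the diagonal of \<open>A * A\<close> into squares.\<close>

lemma trace_square_symmetric:
  fixes A :: "'a :: comm_ring_1 mat"
  assumes A: "A \<in> carrier_mat n n" and sym: "\<And>i j. i < n \<Longrightarrow> j < n \<Longrightarrow> A $$ (i, j) = A $$ (j, i)"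
  shows "mat_trace (A * A) = (\<Sum>i<n. \<Sum>j<n. (A $$ (i, j))\<^sup>2)"
  unfolding mat_trace_def using A
  by (auto simp: mult_mat_index_sum[OF A A] sym power2_eq_square intro!: sum.cong simp del: index_mult_mat(1))

section \<open>Real symmetric matrices\<close>

text \<open>For an eigenvector \<open>v\<close> the form \<open>q = v\<^sup>* A v\<close> equals \<open>k\<close> times the positive real number
  \<open>s = v\<^sup>* v\<close>. Conjugating \<open>q\<close> exchanges the roles of the two summation indices, so \<open>q\<close> is real by
  symmetry of \<open>A\<close>.\<close>

lemma eigenvalue_real_symmetric_is_real:
  fixes A :: "real mat"
  assumes A: "A \<in> carrier_mat n n" and sym: "\<And>i j. i < n \<Longrightarrow> j < n \<Longrightarrow> A $$ (i, j) = A $$ (j, i)"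
    and ev: "eigenvalue (map_mat complex_of_real A) k"
  shows "k \<in> \<real>"
proof -
  let ?C = "map_mat complex_of_real A"
  from ev obtain v where v: "v \<in> carrier_vec n" and v0: "v \<noteq> 0\<^sub>v n" and eq: "?C *\<^sub>v v = k \<cdot>\<^sub>v v"
    using A unfolding eigenvalue_def eigenvector_def by auto
  have comp: "(\<Sum>j<n. complex_of_real (A $$ (i, j)) * v $ j) = k * v $ i" if i: "i < n" for i
  proof -
    have "(?C *\<^sub>v v) $ i = (\<Sum>j<n. complex_of_real (A $$ (i, j)) * v $ j)"
      using i v A by (auto simp: scalar_prod_def lessThan_atLeast0 intro!: sum.cong)
    then show ?thesis using eq i v by simp
  qed
  define q where "q = (\<Sum>i<n. \<Sum>j<n. complex_of_real (A $$ (i, j)) * v $ j * cnj (v $ i))"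
  define s where "s = (\<Sum>i<n. (cmod (v $ i))\<^sup>2)"
  have "cnj q = (\<Sum>i<n. \<Sum>j<n. complex_of_real (A $$ (i, j)) * cnj (v $ j) * v $ i)"
    unfolding q_def by simp
  also have "\<dots> = (\<Sum>j<n. \<Sum>i<n. complex_of_real (A $$ (i, j)) * cnj (v $ j) * v $ i)"
    by (rule sum.swap)
  also have "\<dots> = q"
    unfolding q_def by (intro sum.cong refl) (simp add: sym mult_ac)
  finally have "q \<in> \<real>" by (simp add: complex_is_Real_iff complex_eq_iff)
  have "q = (\<Sum>i<n. k * v $ i * cnj (v $ i))"
    unfolding q_def by (intro sum.cong refl) (simp add: comp flip: sum_distrib_right)
  also have "\<dots> = k * complex_of_real s"
    unfolding s_def of_real_sum sum_distrib_left
    by (intro sum.cong refl) (simp only: complex_norm_square mult.assoc)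
  finally have q: "q = k * complex_of_real s" .
  obtain i where i: "i < n" "v $ i \<noteq> 0"
    using v v0 by (metis carrier_vecD eq_vecI index_zero_vec)
  have "s > 0"
    unfolding s_def by (rule sum_pos2[of _ i]) (use i in auto)
  with q have "k = q / complex_of_real s" by simp
  with \<open>q \<in> \<real>\<close> show ?thesis by simp
qed

text \<open>Over the complex numbers the characteristic polynomial splits; all the roots being real, the
  factorisation is the image of a real one, and it can be pulled back because the embedding of real into
  complex polynomials is injective.\<close>

lemma char_poly_real_symmetric_splits:
  fixes A :: "real mat"
  assumes A: "A \<in> carrier_mat n n" and sym: "\<And>i j. i < n \<Longrightarrow> j < n \<Longrightarrow> A $$ (i, j) = A $$ (j, i)"
  obtains es where "char_poly A = (\<Prod>e\<leftarrow>es. [:- e, 1:])" "length es = n"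
proof -
  let ?C = "map_mat complex_of_real A"
  have C: "?C \<in> carrier_mat n n" using A by simp
  obtain as where cp: "char_poly ?C = (\<Prod>a\<leftarrow>as. [:- a, 1:])" and len: "length as = n"
    using char_poly_factorized[OF C] by blast
  have "a \<in> \<real>" if "a \<in> set as" for a
  proof (rule eigenvalue_real_symmetric_is_real[OF A sym])
    show "eigenvalue ?C a"
      unfolding eigenvalue_root_char_poly[OF C] cp using that
      by (auto simp: poly_prod_list prod_list_zero_iff)
  qed
  then have as: "as = map complex_of_real (map Re as)"
    by (simp add: map_idI comp_def)
  interpret h: map_poly_inj_comm_ring_hom complex_of_real ..
  have "map_poly complex_of_real (char_poly A) = (\<Prod>a\<leftarrow>as. [:- a, 1:])"
    using cp by (simp add: of_real_hom.char_poly_hom[OF A])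
  also have "\<dots> = map_poly complex_of_real (\<Prod>e\<leftarrow>map Re as. [:- e, 1:])"
    by (subst as) (simp add: h.hom_prod_list comp_def)
  finally have "char_poly A = (\<Prod>e\<leftarrow>map Re as. [:- e, 1:])" by simp
  then show thesis using len by (intro that[of "map Re as"]) auto
qed

section \<open>The decreasing list of roots\<close>

lemma mset_proots_linear_factors:
  "proots (\<Prod>e\<leftarrow>es. [:- e, 1:]) = mset (es :: 'a :: idom list)"
proof (induction es)
  case (Cons e es)
  have "(\<Prod>e\<leftarrow>es. [:- e, 1:]) \<noteq> (0 :: 'a poly)" by (auto simp: prod_list_zero_iff)
  then show ?case using Cons by (simp add: proots_mult del: mult_pCons_left)
qed simp

text \<open>A sum over all eigenvalues does not depend on their order, so the sorting in their definition
  can be forgotten. The length \<open>length es\<close> matters: indices beyond the end of the list would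
  select unspecified values.\<close>

lemma sum_nth_rev_sorted_list_of_multiset:
  fixes f :: "'a :: linorder \<Rightarrow> 'b :: comm_monoid_add"
  shows "(\<Sum>i=1..length es. f (rev (sorted_list_of_multiset (mset es)) ! (i - 1))) = sum_list (map f es)"
proof -
  define xs where "xs = rev (sorted_list_of_multiset (mset es))"
  have m: "mset xs = mset es" by (simp add: xs_def)
  then have l: "length xs = length es" by (rule mset_eq_length)
  have "(\<Sum>i=1..length es. f (xs ! (i - 1))) = (\<Sum>i<length xs. f (xs ! i))"
    by (rule sum.reindex_bij_witness[of _ Suc "\<lambda>i. i - 1"]) (auto simp: l)
  also have "\<dots> = sum_list (map f xs)" by (simp add: sum_list_sum_nth lessThan_atLeast0)
  also have "\<dots> = sum_mset (image_mset f (mset es))" by (simp flip: m sum_mset_sum_list)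
  also have "\<dots> = sum_list (map f es)" by (simp flip: sum_mset_sum_list)
  finally show ?thesis by (simp add: xs_def)
qed

section \<open>Counting edges and arcs\<close>

lemma sum_card_fibres_eq:
  assumes "finite X" "finite Y"
  shows "(\<Sum>y\<in>Y. card {x \<in> X. R x y}) = (\<Sum>x\<in>X. card {y \<in> Y. R x y})"
  using sum_multicount_gen[of Y X "\<lambda>y x. R x y" "\<lambda>x. card {y \<in> Y. R x y}"] assms
  by auto

text \<open>Double counting: since no edge is a loop, an edge with end points \<open>a\<close> and \<open>b\<close> is seen from exactly
  the two ordered pairs \<open>(a, b)\<close> and \<open>(b, a)\<close>.\<close>

lemma sum_num_edges_between:
  assumes G: "mixed_graph G" and loopless: "\<And>e u. e \<in> edges G \<Longrightarrow> ends G e \<noteq> Upair u u"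
  shows "(\<Sum>u\<in>verts G. \<Sum>w\<in>verts G. num_edges_between G u w) = 2 * card (edges G)"
proof -
  let ?V = "verts G \<times> verts G"
  have fin: "finite (edges G)" "finite ?V" using G by (auto simp: mixed_graph_def)
  have "(\<Sum>u\<in>verts G. \<Sum>w\<in>verts G. num_edges_between G u w)
      = (\<Sum>p\<in>?V. card {e \<in> edges G. ends G e = Upair (fst p) (snd p)})"
    by (simp add: num_edges_between_def sum.cartesian_product case_prod_beta)
  also have "\<dots> = (\<Sum>e\<in>edges G. card {p \<in> ?V. ends G e = Upair (fst p) (snd p)})"
    by (rule sum_card_fibres_eq) (use fin in auto)
  also have "\<dots> = (\<Sum>e\<in>edges G. 2)"
  proof (rule sum.cong)
    fix e assume e: "e \<in> edges G"
    obtain a b where ab: "ends G e = Upair a b" by (cases "ends G e")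
    have "a \<noteq> b" using loopless[OF e, of a] ab by auto
    have "set_uprod (ends G e) \<subseteq> verts G" using G e by (auto simp: mixed_graph_def)
    then have "{p \<in> ?V. ends G e = Upair (fst p) (snd p)} = {(a, b), (b, a)}"
      by (auto simp: ab)
    then show "card {p \<in> ?V. ends G e = Upair (fst p) (snd p)} = 2"
      using \<open>a \<noteq> b\<close> by simp
  qed simp
  finally show ?thesis by simp
qed

lemma sum_num_arcs_from_to:
  assumes G: "mixed_graph G"
  shows "(\<Sum>u\<in>verts G. \<Sum>w\<in>verts G. num_arcs_from_to G u w) = card (arcs G)"
proof -
  let ?V = "verts G \<times> verts G"
  have fin: "finite (arcs G)" "finite ?V" using G by (auto simp: mixed_graph_def)
  have "(\<Sum>u\<in>verts G. \<Sum>w\<in>verts G. num_arcs_from_to G u w)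
      = (\<Sum>p\<in>?V. card {a \<in> arcs G. tail G a = fst p \<and> head G a = snd p})"
    by (simp add: num_arcs_from_to_def sum.cartesian_product case_prod_beta)
  also have "\<dots> = (\<Sum>a\<in>arcs G. card {p \<in> ?V. tail G a = fst p \<and> head G a = snd p})"
    by (rule sum_card_fibres_eq) (use fin in auto)
  also have "\<dots> = (\<Sum>a\<in>arcs G. 1)"
  proof (rule sum.cong)
    fix a assume a: "a \<in> arcs G"
    have "{p \<in> ?V. tail G a = fst p \<and> head G a = snd p} = {(tail G a, head G a)}"
      using G a by (auto simp: mixed_graph_def)
    then show "card {p \<in> ?V. tail G a = fst p \<and> head G a = snd p} = 1" by simp
  qed simp
  finally show ?thesis by simp
qed

text \<open>For the set of edges joining two given vertices, or of arcs from one to the other, uniqueness is the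
  absence of parallel edges and arcs: multiplicities in a simple graph are 0 or 1, hence equal to their
  squares.\<close>

lemma square_card_at_most_one:
  assumes "finite X" "\<And>x y. x \<in> X \<Longrightarrow> y \<in> X \<Longrightarrow> x = y"
  shows "(card X)\<^sup>2 = card X"
proof -
  have "card X \<le> 1" using assms by (simp add: card_le_Suc0_iff_eq)
  then show ?thesis by (cases "card X") auto
qed

lemma simple_num_edges_between_square:
  assumes "simple_mixed_graph G"
  shows "(num_edges_between G u w)\<^sup>2 = num_edges_between G u w"
  unfolding num_edges_between_def
  by (rule square_card_at_most_one)
     (use assms in \<open>auto simp: simple_mixed_graph_def mixed_graph_def\<close>)

lemma simple_num_arcs_from_to_square:
  assumes "simple_mixed_graph G"
  shows "(num_arcs_from_to G u w)\<^sup>2 = num_arcs_from_to G u w"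
  unfolding num_arcs_from_to_def
  by (rule square_card_at_most_one)
     (use assms in \<open>auto simp: simple_mixed_graph_def mixed_graph_def\<close>)

lemma simple_num_edges_between_self:
  assumes "simple_mixed_graph G"
  shows "num_edges_between G u u = 0"
proof -
  have "{e \<in> edges G. ends G e = Upair u u} = {}"
    using assms by (auto simp: simple_mixed_graph_def)
  then show ?thesis unfolding num_edges_between_def by (simp only: card.empty)
qed

section \<open>The integrated adjacency matrix\<close>

lemma sum_lessThan_add_split:
  fixes f :: "nat \<Rightarrow> 'a :: comm_monoid_add"
  shows "(\<Sum>i<n + m. f i) = (\<Sum>i<n. f i) + (\<Sum>i<m. f (n + i))"
  by (induction m) (auto simp: add_ac)

lemma num_edges_between_commute: "num_edges_between G u w = num_edges_between G w u"
  unfolding num_edges_between_def by (metis Upair_inject)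

lemma integrated_adjacency_matrix_carrier:
  assumes "card (verts G) = n"
  shows "integrated_adjacency_matrix G v \<in> carrier_mat (2 * n) (2 * n)"
  unfolding integrated_adjacency_matrix_def mult_2
  by (rule four_block_carrier_mat) (auto simp: edge_block_def assms)

lemma integrated_adjacency_matrix_index:
  fixes G :: "('v, 'e, 'a) mixed_graph" and v :: "nat \<Rightarrow> 'v"
  assumes n: "card (verts G) = n" and ij: "i < n" "j < n"
  defines "M \<equiv> integrated_adjacency_matrix G v"
  shows "M $$ (i, j) = edge_block G v $$ (i, j)"
    and "M $$ (i, n + j) = arc_block G v $$ (i, j)"
    and "M $$ (n + i, j) = arc_block G v $$ (j, i)"
    and "M $$ (n + i, n + j) = edge_block G v $$ (i, j)"
  unfolding M_def integrated_adjacency_matrix_def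
  using ij by (simp_all add: edge_block_def arc_block_def n)

lemma integrated_adjacency_matrix_symmetric:
  assumes n: "card (verts G) = n" and "i < 2 * n" "j < 2 * n"
  shows "integrated_adjacency_matrix G v $$ (i, j) = integrated_adjacency_matrix G v $$ (j, i)"
proof -
  have split: "k < n \<or> (\<exists>k'<n. k = n + k')" if "k < 2 * n" for k
    using that by presburger
  have sym: "edge_block G v $$ (k, l) = edge_block G v $$ (l, k)" if "k < n" "l < n" for k l
    using that by (simp add: edge_block_def n num_edges_between_commute)
  show ?thesis
    using split[OF assms(2)] split[OF assms(3)]
    by (elim disjE exE conjE) (simp_all add: integrated_adjacency_matrix_index[OF n] sym)
qed

lemma mat_trace_integrated_adjacency_matrix:
  assumes G: "simple_mixed_graph G"
  shows "mat_trace (integrated_adjacency_matrix G v) = 0"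
proof -
  define n where "n = card (verts G)"
  have "mat_trace (integrated_adjacency_matrix G v)
      = (\<Sum>i<n + n. integrated_adjacency_matrix G v $$ (i, i))"
    using integrated_adjacency_matrix_carrier[OF n_def[symmetric], of v]
    by (simp add: mat_trace_def mult_2)
  also have "\<dots> = 2 * (\<Sum>i<n. edge_block G v $$ (i, i))"
    by (simp add: sum_lessThan_add_split integrated_adjacency_matrix_index[OF n_def[symmetric]])
  also have "(\<Sum>i<n. edge_block G v $$ (i, i)) = 0"
    by (simp add: edge_block_def simple_num_edges_between_self[OF G] flip: n_def)
  finally show ?thesis by simp
qed

lemma sum_squares_integrated_adjacency_matrix:
  assumes G: "simple_mixed_graph G" and n: "card (verts G) = n" and v: "bij_betw v {0..<n} (verts G)"
  shows "(\<Sum>i<2*n. \<Sum>j<2*n. (integrated_adjacency_matrix G v $$ (i, j))\<^sup>2)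
       = 4 * real (card (edges G)) + 2 * real (card (arcs G))"
proof -
  have mg: "mixed_graph G" and loopless: "\<And>e u. e \<in> edges G \<Longrightarrow> ends G e \<noteq> Upair u u"
    using G by (auto simp: simple_mixed_graph_def)
  have reindex: "(\<Sum>i<n. \<Sum>j<n. f (v i) (v j)) = (\<Sum>u\<in>verts G. \<Sum>w\<in>verts G. f u w)"
    for f :: "_ \<Rightarrow> _ \<Rightarrow> real"
    by (simp add: lessThan_atLeast0 sum.reindex_bij_betw[OF v]
        sum.reindex_bij_betw[OF v, of "\<lambda>u. sum (f u) (verts G)"])
  have sq: "(real k)\<^sup>2 = real k" if "k\<^sup>2 = k" for k :: nat
    using that by (metis of_nat_power)
  have "(\<Sum>i<n. \<Sum>j<n. (edge_block G v $$ (i, j))\<^sup>2)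
      = (\<Sum>i<n. \<Sum>j<n. real (num_edges_between G (v i) (v j)))"
    by (intro sum.cong refl)
       (auto simp: edge_block_def n simple_num_edges_between_self[OF G]
          sq[OF simple_num_edges_between_square[OF G]])
  also have "\<dots> = 2 * real (card (edges G))"
    unfolding reindex[of "\<lambda>u w. real (num_edges_between G u w)"]
    using arg_cong[OF sum_num_edges_between[OF mg loopless], of real] by simp
  finally have E: "(\<Sum>i<n. \<Sum>j<n. (edge_block G v $$ (i, j))\<^sup>2) = 2 * real (card (edges G))" .
  have "(\<Sum>i<n. \<Sum>j<n. (arc_block G v $$ (i, j))\<^sup>2)
      = (\<Sum>i<n. \<Sum>j<n. real (num_arcs_from_to G (v i) (v j)))"
    by (intro sum.cong refl)
       (auto simp: arc_block_def n sq[OF simple_num_arcs_from_to_square[OF G]])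
  also have "\<dots> = real (card (arcs G))"
    unfolding reindex[of "\<lambda>u w. real (num_arcs_from_to G u w)"]
    using arg_cong[OF sum_num_arcs_from_to[OF mg], of real] by simp
  finally have D: "(\<Sum>i<n. \<Sum>j<n. (arc_block G v $$ (i, j))\<^sup>2) = real (card (arcs G))" .
  have DT: "(\<Sum>i<n. \<Sum>j<n. (arc_block G v $$ (j, i))\<^sup>2) = real (card (arcs G))"
    by (subst sum.swap) (rule D)
  have "(\<Sum>i<n+n. \<Sum>j<n+n. (integrated_adjacency_matrix G v $$ (i, j))\<^sup>2)
      = (\<Sum>i<n. \<Sum>j<n. (edge_block G v $$ (i, j))\<^sup>2) + (\<Sum>i<n. \<Sum>j<n. (arc_block G v $$ (j, i))\<^sup>2)
      + ((\<Sum>i<n. \<Sum>j<n. (arc_block G v $$ (i, j))\<^sup>2) + (\<Sum>i<n. \<Sum>j<n. (edge_block G v $$ (i, j))\<^sup>2))"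
    unfolding sum_lessThan_add_split sum.distrib
    by (intro arg_cong2[where f = "(+)"] sum.cong refl)
       (simp_all only: integrated_adjacency_matrix_index[OF n] lessThan_iff)
  then show ?thesis
    unfolding E D DT mult_2[of n] by linarith
qed

theorem theorem4p1:
  fixes G :: "('v, 'e, 'a) mixed_graph" and v :: "nat \<Rightarrow> 'v" and n :: nat
  assumes "simple_mixed_graph G"
    and "card (verts G) = n"
    and "bij_betw v {0..<n} (verts G)"
  shows "(\<Sum>i=1..2*n. I_eigenvalue G v i) = 0 \<and>
         (\<Sum>i=1..2*n. (I_eigenvalue G v i)\<^sup>2) = 4 * real (card (edges G)) + 2 * real (card (arcs G))"
proof -
  define M where "M = integrated_adjacency_matrix G v"
  have M: "M \<in> carrier_mat (2 * n) (2 * n)"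
    unfolding M_def by (rule integrated_adjacency_matrix_carrier[OF assms(2)])
  have sym: "M $$ (i, j) = M $$ (j, i)" if "i < 2 * n" "j < 2 * n" for i j
    unfolding M_def by (rule integrated_adjacency_matrix_symmetric[OF assms(2) that])
  obtain es where cp: "char_poly M = (\<Prod>e\<leftarrow>es. [:- e, 1:])" and len: "length es = 2 * n"
    by (rule char_poly_real_symmetric_splits[OF M sym])
  have power_sum: "(\<Sum>i=1..2*n. f (I_eigenvalue G v i)) = sum_list (map f es)" for f :: "real \<Rightarrow> real"
    using sum_nth_rev_sorted_list_of_multiset[of f es]
    by (simp add: I_eigenvalue_def cp len mset_proots_linear_factors flip: M_def)
  have "(\<Sum>i=1..2*n. I_eigenvalue G v i) = mat_trace M"
    using power_sum[of "\<lambda>x. x"] trace_eq_sum_roots(1)[OF M cp] by simp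
  moreover have "mat_trace M = 0"
    unfolding M_def by (rule mat_trace_integrated_adjacency_matrix[OF assms(1)])
  moreover have "(\<Sum>i=1..2*n. (I_eigenvalue G v i)\<^sup>2) = mat_trace (M * M)"
    using power_sum[of "\<lambda>x. x\<^sup>2"] trace_eq_sum_roots(2)[OF M cp] by simp
  moreover have "mat_trace (M * M) = (\<Sum>i<2*n. \<Sum>j<2*n. (M $$ (i, j))\<^sup>2)"
    by (rule trace_square_symmetric[OF M sym])
  moreover have "\<dots> = 4 * real (card (edges G)) + 2 * real (card (arcs G))"
    unfolding M_def by (rule sum_squares_integrated_adjacency_matrix[OF assms])
  ultimately show ?thesis by (simp only: simp_thms)
qed

end
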